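(* For any field $F$, the element $t$ of the field of rational fractions $F(t)$ does not admit a balanced decomposition into a product of three factors; that is, there are no $a_1,a_2,a_3\in F(t)$ such that $a_1a_2a_3=t$ and $a_1+a_2+a_3=0$.
   Context: $F(t)$ denotes the field of rational functions in one indeterminate $t$ over $F$. A factorisation $a=a_1a_2\cdots a_k$ of an element of a ring is called balanced if $a_1+\dots+a_k=0$. *)

theory Defs
  imports "HOL-Computational_Algebra.Computational_Algebra"
begin

text \<open>The field of rational functions over a field \<open>'a\<close> is the type \<open>'a poly fract\<close>.\<close>

definition indeterminate :: "'a::field poly fract" where
  "indeterminate = to_fract [:0, 1:]"

definition balanced_factorisation :: "'a::ring_1 list \<Rightarrow> 'a \<Rightarrow> bool" where
  "balanced_factorisation as a \<longleftrightarrow> prod_list as = a \<and> sum_list as = 0"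

end

theory Submission
  imports Defs
begin

text \<open>
  Clearing denominators turns the claim into one about polynomials: if \<open>p1 + p2 + p3 = 0\<close> and
  \<open>p1 * p2 * p3 = t * q ^ 3\<close>, then \<open>q = 0\<close>. Geometrically, \<open>a * b * (a + b) = -t\<close> is a twist over
  \<open>F(t)\<close> of the constant cubic \<open>a * b * (a + b) = -1\<close>, and the twist disappears once a cube root
  of \<open>t\<close> is adjoined.

  In characteristic other than 3, substitute \<open>t = s ^ 3\<close>. The right-hand side becomes a cube, and
  dividing by the greatest common divisor \<open>g\<close> of the three polynomials leaves pairwise coprime
  \<open>r1, r2, r3\<close> with sum zero and product a cube \<open>Q ^ 3\<close>. Such data are constant because the cubic
  has genus one; the elementary form of this is a Mason-Stothers argument
  (\<open>coprime_balanced_cube_constant\<close>). The Wronskian \<open>W\<close> of any two of the \<open>r\<close>'s is the same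
  polynomial. It is divisible by \<open>Q ^ 2\<close>, since a prime occurs in one \<open>r\<close> only, with a multiplicity
  at least three times that in \<open>Q\<close>, and derivation lowers this by at most one
  (\<open>square_dvd_wronskian\<close>). Its degree is smaller than the sum of the degrees of any two \<open>r\<close>'s.
  Adding up the three bounds gives \<open>3 * degree W < 2 * (3 * degree Q) \<le> 3 * degree W\<close> unless
  \<open>W = 0\<close>. If \<open>W = 0\<close>, all derivatives vanish by coprimality, everything is a polynomial in
  \<open>s ^ c\<close> with \<open>c\<close> the characteristic; so \<open>Q\<close> is constant, or \<open>c > 0\<close> and replacing \<open>s ^ c\<close> by
  \<open>s\<close> lowers its degree.
  As \<open>r1\<close> and \<open>Q\<close> are constant, \<open>g\<close> has the degree of \<open>p1(s ^ 3)\<close>, a multiple of 3, but also the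
  degree of \<open>s * q(s ^ 3)\<close>, which is 1 modulo 3: a contradiction.

  In characteristic 3 cubes have derivative zero. With \<open>g\<close> and the \<open>r\<close>'s taken over \<open>F[t]\<close> itself,
  the product \<open>N = r1 * r2 * r3\<close> satisfies \<open>N = t * N'\<close>, while \<open>N'\<close> is a multiple of
  \<open>d = r1 - r2\<close>, which is coprime to \<open>N\<close>. Hence \<open>d\<close> is constant, \<open>N = t * N'\<close> reads
  \<open>r1 ^ 3 - r1 * d ^ 2 = - t * d ^ 2 * r1'\<close>, and comparing degrees forces \<open>r1\<close> to be constant and
  then \<open>N = 0\<close>.
\<close>

section \<open>Coprime polynomials over a field\<close>

lemma poly_bezout:
  fixes p q :: "'a::field poly"
  shows "\<exists>g u v. g dvd p \<and> g dvd q \<and> g = u * p + v * q"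
  \<comment> \<open>Euclid's algorithm; the measure ranks the zero polynomial strictly below the constants.\<close>
proof (induction "if q = 0 then 0 else Suc (degree q)" arbitrary: p q rule: less_induct)
  case less
  show ?case
  proof (cases "q = 0")
    case True
    then have "p dvd p \<and> p dvd q \<and> p = 1 * p + 0 * q" by simp
    then show ?thesis by blast
  next
    case False
    then have "p mod q = 0 \<or> degree (p mod q) < degree q"
      by (rule degree_mod_less)
    then have "(if p mod q = 0 then 0 else Suc (degree (p mod q))) < (if q = 0 then 0 else Suc (degree q))"
      using False by auto
    from less[OF this] obtain g u v
      where g: "g dvd q" "g dvd p mod q" "g = u * q + v * (p mod q)"
      by blast
    have "g dvd p"
      using g by (metis dvd_add dvd_mult mult.commute div_mult_mod_eq)
    moreover have "g = v * p + (u - v * (p div q)) * q"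
      using g(3) by (simp add: algebra_simps minus_div_mult_eq_mod [symmetric])
    ultimately show ?thesis using g(1) by blast
  qed
qed

lemma coprime_poly_iff_bezout:
  fixes p q :: "'a::field poly"
  shows "coprime p q \<longleftrightarrow> (\<exists>u v. u * p + v * q = 1)"
proof
  assume "coprime p q"
  moreover obtain g u v where g: "g dvd p" "g dvd q" "g = u * p + v * q"
    using poly_bezout by blast
  ultimately have "g dvd 1" using coprime_common_divisor by blast
  then obtain k where "1 = g * k" by (elim dvdE)
  then have "(k * u) * p + (k * v) * q = 1"
    using g(3) by (simp add: algebra_simps)
  then show "\<exists>u v. u * p + v * q = 1" by blast
next
  assume "\<exists>u v. u * p + v * q = 1"
  then obtain u v where uv: "u * p + v * q = 1" by blast
  show "coprime p q"
  proof (rule coprimeI)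
    fix c assume "c dvd p" "c dvd q"
    then have "c dvd u * p + v * q" by simp
    then show "c dvd 1" using uv by simp
  qed
qed

text \<open>Here \<open>g\<close> is a greatest common divisor of \<open>p\<close> and \<open>q\<close>.\<close>

lemma poly_coprime_cofactors:
  fixes p q :: "'a::field poly"
  assumes "p \<noteq> 0"
  obtains g r s where "p = g * r" "q = g * s" "coprime r s"
proof -
  obtain g u v where g: "g dvd p" "g dvd q" "g = u * p + v * q"
    using poly_bezout by blast
  obtain r s where rs: "p = g * r" "q = g * s"
    using g(1,2) by (elim dvdE)
  have "g * (u * r + v * s) = g * 1"
    using g(3) rs by (simp add: algebra_simps)
  then have "u * r + v * s = 1"
    using assms rs(1) by simp
  then have "coprime r s" using coprime_poly_iff_bezout by blast
  with rs that show thesis by blast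
qed

text \<open>Multiply a Bezout relation \<open>u * p + v * q = 1\<close> by \<open>k\<close>.\<close>

lemma coprime_poly_dvd_cancel:
  fixes p q :: "'a::field poly"
  assumes "coprime p q" "d dvd k * p" "d dvd k * q"
  shows "d dvd k"
proof -
  obtain u v where uv: "u * p + v * q = 1"
    using assms(1) coprime_poly_iff_bezout by blast
  have "k = u * (k * p) + v * (k * q)"
    using arg_cong[OF uv, of "\<lambda>x. k * x"] by (simp add: algebra_simps)
  moreover have "d dvd u * (k * p) + v * (k * q)"
    using assms(2,3) by (meson dvd_add dvd_mult)
  ultimately show ?thesis by simp
qed

lemma coprime_poly_power:
  fixes p q :: "'a::field poly"
  assumes "coprime p q"
  shows "coprime (p ^ n) q"
proof (induction n)
  case (Suc n)
  show ?case
  proof (rule coprimeI)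
    fix c assume c: "c dvd p ^ Suc n" "c dvd q"
    have "c dvd p ^ n"
      using coprime_poly_dvd_cancel[OF assms, of c "p ^ n"] c by (simp add: mult.commute)
    then show "c dvd 1" using Suc c(2) coprime_common_divisor by blast
  qed
qed simp

text \<open>In lowest terms \<open>q / g = b / a\<close>, the hypothesis makes \<open>a\<close> a divisor of \<open>b ^ n\<close>, to which it is
  coprime; so \<open>a\<close> is a unit.\<close>

lemma poly_power_dvd_power_imp_dvd:
  fixes g q :: "'a::field poly"
  assumes "g ^ n dvd q ^ n" "g \<noteq> 0" "n > 0"
  shows "g dvd q"
proof -
  obtain h a b where h: "g = h * a" "q = h * b" "coprime a b"
    using poly_coprime_cofactors[OF assms(2)] by metis
  have "h ^ n \<noteq> 0" using assms(2) h(1) by auto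
  then have "a ^ n dvd b ^ n"
    using assms(1) unfolding h(1,2) power_mult_distrib by (subst (asm) dvd_mult_cancel_left) blast
  then have "a dvd b ^ n" using assms(3) by (meson dvd_power dvd_trans)
  moreover have "coprime (b ^ n) a"
    using h(3) by (intro coprime_poly_power) (simp add: coprime_commute)
  ultimately have "a dvd 1" by (meson coprime_common_divisor dvd_refl)
  then show ?thesis using h by (simp add: mult_dvd_mono unit_imp_dvd)
qed

section \<open>Wronskians of balanced triples\<close>

definition wronskian :: "'a::field poly \<Rightarrow> 'a poly \<Rightarrow> 'a poly" where
  "wronskian p q = p * pderiv q - pderiv p * q"

lemma degree_pderiv_le: "degree (pderiv p) \<le> degree p - 1"
  by (rule degree_le) (auto simp: coeff_pderiv coeff_eq_0)

lemma degree_wronskian: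
  assumes "wronskian p q \<noteq> 0"
  shows "degree (wronskian p q) < degree p + degree q"
proof -
  have z: "pderiv f = 0" if "degree f = 0" for f :: "'a poly"
    using that by (metis degree_eq_zeroE pderiv_singleton)
  have pos: "0 < degree p + degree q"
    using assms z by (fastforce simp: wronskian_def)
  have "degree (p * pderiv q) \<le> degree p + degree q - 1"
    using z[of q] degree_pderiv_le[of q] degree_mult_le[of p "pderiv q"] by (cases "degree q = 0") auto
  moreover have "degree (pderiv p * q) \<le> degree p + degree q - 1"
    using z[of p] degree_pderiv_le[of p] degree_mult_le[of "pderiv p" q] by (cases "degree p = 0") auto
  ultimately have "degree (wronskian p q) \<le> degree p + degree q - 1"
    unfolding wronskian_def by (rule degree_diff_le)
  then show ?thesis using pos by linarith
qed

lemma wronskian_balanced: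
  assumes "p1 + p2 + p3 = 0"
  shows "wronskian p2 p3 = wronskian p1 p2" "wronskian p3 p1 = wronskian p1 p2"
proof -
  have p3: "p3 = - p1 - p2" using assms by (simp add: eq_neg_iff_add_eq_0 algebra_simps)
  show "wronskian p2 p3 = wronskian p1 p2" "wronskian p3 p1 = wronskian p1 p2"
    unfolding p3 wronskian_def by (simp_all add: pderiv_diff pderiv_minus algebra_simps)
qed

text \<open>The form with a coefficient 3 serves both characteristics: in characteristic 3 the first term
  drops out, and otherwise, multiplied by \<open>p3\<close>, it becomes a multiple of the product itself.\<close>

lemma pderiv_balanced_product:
  assumes "p1 + p2 + p3 = 0"
  shows "pderiv (p1 * p2 * p3) = 3 * (p1 * p2 * pderiv p3) - wronskian p1 p2 * (p1 - p2)"
proof -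
  have p3: "p3 = - p1 - p2" using assms by (simp add: eq_neg_iff_add_eq_0 algebra_simps)
  show ?thesis
    unfolding p3 wronskian_def
    by (simp add: pderiv_mult pderiv_diff pderiv_minus algebra_simps)
qed

text \<open>
  Instead of factoring \<open>q\<close> into primes, the proof multiplies \<open>pderiv_balanced_product\<close> by \<open>p3\<close>. As
  \<open>q ^ 2\<close> divides both \<open>q ^ 3\<close> and its derivative, it divides \<open>wronskian p1 p2 * (p1 - p2) * p3\<close>, and
  likewise the cyclic variants. The quadratic forms that arise here have only the trivial common zero
  outside characteristic 3, so their ideal contains \<open>3 * p1 ^ 3\<close> and \<open>3 * p2 ^ 3\<close>; coprimality then leaves
  the Wronskian.
\<close>

lemma square_dvd_wronskian:
  fixes p1 p2 p3 q :: "'a::field poly"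
  assumes char: "(3::'a) \<noteq> 0" and cop: "coprime p1 p2"
    and bal: "p1 + p2 + p3 = 0" and cube: "p1 * p2 * p3 = q ^ 3"
  shows "q ^ 2 dvd wronskian p1 p2"
proof -
  have aux: "q ^ 2 dvd wronskian p1 p2 * ((a - b) * c)"
    if "a + b + c = 0" "a * b * c = q ^ 3" "wronskian a b = wronskian p1 p2" for a b c
  proof -
    have "wronskian a b * ((a - b) * c) = c * (3 * (a * b * pderiv c) - pderiv (a * b * c))"
      unfolding pderiv_balanced_product[OF that(1)] by (simp add: algebra_simps)
    also have "\<dots> = 3 * pderiv c * (a * b * c) - c * pderiv (a * b * c)"
      by (simp add: algebra_simps)
    also have "\<dots> = q ^ 2 * (3 * pderiv c * q - c * (3 * pderiv q))"
      unfolding that(2)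
      by (simp add: pderiv_mult algebra_simps power2_eq_square power3_eq_cube)
    finally show ?thesis using that(3) by simp
  qed
  define w where "w = wronskian p1 p2"
  have p3: "p3 = - p1 - p2" using bal by (simp add: eq_neg_iff_add_eq_0 algebra_simps)
  have A: "q ^ 2 dvd w * (p2 ^ 2 - p1 ^ 2)"
    using aux[of p1 p2 p3] bal cube unfolding w_def p3
    by (simp add: algebra_simps power2_eq_square)
  have B: "q ^ 2 dvd w * (p1 ^ 2 + 2 * p1 * p2)"
    using aux[of p2 p3 p1] bal cube wronskian_balanced[OF bal] unfolding w_def p3
    by (simp add: algebra_simps power2_eq_square)
  have C: "q ^ 2 dvd 3 * w * (p1 ^ 1 * p2 ^ 2)"
  proof -
    have "3 * w * (p1 ^ 1 * p2 ^ 2) = (2 * p2 - p1) * (w * (p1 ^ 2 + 2 * p1 * p2))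
            - p1 * (w * (p2 ^ 2 - p1 ^ 2))"
      by (simp add: algebra_simps power2_eq_square)
    then show ?thesis using A B by (metis dvd_diff dvd_mult)
  qed
  have "3 * w * p1 ^ 3 = 3 * w * (p1 ^ 1 * p2 ^ 2) - 3 * p1 * (w * (p2 ^ 2 - p1 ^ 2))"
    by (simp add: algebra_simps power2_eq_square power3_eq_cube)
  then have X: "q ^ 2 dvd 3 * w * p1 ^ 3"
    using A C by (metis dvd_diff dvd_mult)
  have "3 * w * p2 ^ 3 = 3 * p2 * (w * (p2 ^ 2 - p1 ^ 2)) + 3 * p2 * (w * (p1 ^ 2 + 2 * p1 * p2))
          - 2 * (3 * w * (p1 ^ 1 * p2 ^ 2))"
    by (simp add: algebra_simps power2_eq_square power3_eq_cube)
  then have Y: "q ^ 2 dvd 3 * w * p2 ^ 3"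
    using A B C by (metis dvd_add dvd_diff dvd_mult)
  have "coprime (p1 ^ 3) (p2 ^ 3)"
    using cop by (intro coprime_poly_power) (metis coprime_commute coprime_poly_power)
  then have "q ^ 2 dvd 3 * w"
    using X Y by (rule coprime_poly_dvd_cancel)
  then have "q ^ 2 dvd smult 3 w" by (simp add: numeral_poly)
  then show ?thesis using char by (simp add: dvd_smult_iff w_def)
qed

text \<open>Coprimality and \<open>p * q' = p' * q\<close> make \<open>p\<close> divide \<open>p'\<close>, which is impossible by degree unless
  \<open>p' = 0\<close>.\<close>

lemma wronskian_eq_0_imp_pderiv_eq_0:
  assumes "wronskian p q = 0" "coprime p q" "p \<noteq> 0"
  shows "pderiv p = 0"
proof (rule ccontr)
  assume nz: "pderiv p \<noteq> 0"
  have eq: "pderiv p * q = p * pderiv q"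
    using assms(1) by (simp add: wronskian_def)
  have "p dvd pderiv p"
  proof (rule coprime_poly_dvd_cancel[OF assms(2)])
    show "p dvd pderiv p * q" unfolding eq by simp
  qed simp
  then have "degree p \<le> degree (pderiv p)"
    using nz by (rule dvd_imp_degree_le)
  then have "degree p = 0" using degree_pderiv_le[of p] by linarith
  then show False using nz by (metis degree_eq_zeroE pderiv_singleton)
qed

section \<open>Polynomials with vanishing derivative\<close>

lemma pcompose_monom_monom:
  "pcompose (monom a k) (monom 1 c) = monom (a::'a::comm_semiring_1) (c * k)"
proof (induction k)
  case (Suc k)
  then show ?case
    by (simp add: monom_Suc pcompose_pCons mult_monom)
qed (simp add: monom_0)

text \<open>In characteristic 0 the inner polynomial is \<open>monom 1 0 = 1\<close>, so that the statement says that
  \<open>p\<close> is constant.\<close>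

lemma pderiv_eq_0_imp_pcompose_monom:
  fixes p :: "'a::field poly"
  assumes "pderiv p = 0"
  shows "\<exists>r. p = pcompose r (monom 1 CHAR('a))"
proof -
  have zero: "coeff p i = 0" if "\<not> CHAR('a) dvd i" for i
  proof -
    from that obtain j where j: "i = Suc j" by (cases i) auto
    have "of_nat i * coeff p i = 0"
      using assms coeff_pderiv[of p j] j by simp
    then show ?thesis using that by (simp add: of_nat_eq_0_iff_char_dvd)
  qed
  have "pcompose (\<Sum>i\<le>degree p. monom (coeff p i) (i div CHAR('a))) (monom 1 CHAR('a))
          = (\<Sum>i\<le>degree p. monom (coeff p i) (CHAR('a) * (i div CHAR('a))))"
    by (simp add: pcompose_sum pcompose_monom_monom)
  also have "\<dots> = (\<Sum>i\<le>degree p. monom (coeff p i) i)"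
  proof (rule sum.cong[OF refl])
    fix i
    show "monom (coeff p i) (CHAR('a) * (i div CHAR('a))) = monom (coeff p i) i"
      using zero[of i] by (cases "CHAR('a) dvd i") auto
  qed
  also have "\<dots> = p" by (rule poly_as_sum_of_monoms)
  finally show ?thesis by metis
qed

lemma pcompose_power: "pcompose (p ^ n) q = (pcompose p q) ^ n" for p q :: "'a::comm_semiring_1 poly"
  by (induction n) (simp_all add: pcompose_mult pcompose_1)

lemma coprime_pcompose_imp_coprime:
  fixes p q f :: "'a::field poly"
  assumes "coprime (pcompose p f) (pcompose q f)" "degree f > 0"
  shows "coprime p q"
proof (rule coprimeI)
  fix c assume c: "c dvd p" "c dvd q"
  then have "pcompose c f dvd pcompose p f" "pcompose c f dvd pcompose q f"
    by (metis dvd_def pcompose_mult)+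
  with assms(1) have u: "pcompose c f dvd 1" using coprime_common_divisor by blast
  then have "degree (pcompose c f) \<le> 0" 
    using dvd_imp_degree_le[OF u] by simp
  then have "degree c = 0" using assms(2) by (simp add: degree_pcompose)
  moreover have "c \<noteq> 0" using u by auto
  ultimately show "c dvd 1" by (simp add: is_unit_iff_degree)
qed

section \<open>Balanced products that are cubes\<close>

text \<open>The Mason-Stothers argument of the introduction, by induction on the degree of \<open>q\<close> to deal
  with vanishing derivatives in positive characteristic.\<close>

lemma coprime_balanced_cube_constant:
  fixes p1 p2 p3 q :: "'a::field poly"
  assumes char: "(3::'a) \<noteq> 0" and "coprime p1 p2"
    and "p1 + p2 + p3 = 0" and "p1 * p2 * p3 = q ^ 3" and "q \<noteq> 0"
  shows "degree q = 0"
  using assms(2-)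
proof (induction "degree q" arbitrary: p1 p2 p3 q rule: less_induct)
  case less
  note cop = less.prems(1) and bal = less.prems(2) and cube = less.prems(3)
  let ?w = "wronskian p1 p2"
  have nz: "p1 \<noteq> 0" "p2 \<noteq> 0" "p3 \<noteq> 0" using cube less.prems(4) by auto
  have deg: "degree p1 + degree p2 + degree p3 = 3 * degree q"
    using nz arg_cong[OF cube, of degree] by (simp add: degree_mult_eq degree_power_eq less.prems(4))
  have w: "?w = 0"
  proof (rule ccontr)
    assume w: "?w \<noteq> 0"
    have "degree ?w < degree p1 + degree p2" "degree ?w < degree p2 + degree p3"
         "degree ?w < degree p3 + degree p1"
      using degree_wronskian w wronskian_balanced[OF bal] by metis+
    moreover have "2 * degree q \<le> degree ?w"
      using dvd_imp_degree_le[OF square_dvd_wronskian[OF char cop bal cube] w]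
      by (simp add: degree_power_eq less.prems(4))
    ultimately show False using deg by linarith
  qed
  \<comment> \<open>All derivatives vanish, so the whole configuration descends along \<open>x \<mapsto> x ^ CHAR('a)\<close>.\<close>
  have d1: "pderiv p1 = 0"
    by (rule wronskian_eq_0_imp_pderiv_eq_0[OF w cop nz(1)])
  have d2: "pderiv p2 = 0"
  proof (rule wronskian_eq_0_imp_pderiv_eq_0)
    show "wronskian p2 p1 = 0" using w by (simp add: wronskian_def algebra_simps)
    show "coprime p2 p1" using cop by (simp add: coprime_commute)
  qed (rule nz)
  have p3: "p3 = - p1 - p2" using bal by (simp add: eq_neg_iff_add_eq_0 algebra_simps)
  have d3: "pderiv p3 = 0" unfolding p3 by (simp add: pderiv_diff pderiv_minus d1 d2)
  have "pderiv (q ^ 3) = 0"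
    unfolding cube[symmetric] by (simp add: pderiv_mult d1 d2 d3)
  then have dq: "pderiv q = 0"
    using char less.prems(4) by (simp add: pderiv_power)
  let ?f = "monom (1::'a) CHAR('a)"
  obtain r1 r2 r3 s where r: "p1 = pcompose r1 ?f" "p2 = pcompose r2 ?f" 
      "p3 = pcompose r3 ?f" "q = pcompose s ?f"
    using d1 d2 d3 dq pderiv_eq_0_imp_pcompose_monom by metis
  have degf: "degree ?f = CHAR('a)" by (simp add: degree_monom_eq)
  show ?case
  proof (cases "CHAR('a) = 0")
    case True
    then show ?thesis using degf r(4) by (simp add: degree_pcompose)
  next
    case False
    have fpos: "degree ?f > 0" using False degf by simp
    show ?thesis
    proof (rule ccontr)
      assume q0: "degree q \<noteq> 0"
      have "CHAR('a) \<ge> 2" using False CHAR_not_1'[where ?'a='a] by linarith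
      then have "degree s < degree q"
        using q0 degf r(4) by (auto simp: degree_pcompose)
      moreover have "coprime r1 r2"
        using cop fpos unfolding r by (rule coprime_pcompose_imp_coprime)
      moreover have "r1 + r2 + r3 = 0"
        using bal fpos unfolding r by (simp flip: pcompose_add add: pcompose_eq_0_iff)
      moreover have "r1 * r2 * r3 = s ^ 3"
      proof -
        have "pcompose (r1 * r2 * r3 - s ^ 3) ?f = 0"
          using cube unfolding r by (simp add: pcompose_diff pcompose_mult pcompose_power)
        then show ?thesis using fpos by (simp add: pcompose_eq_0_iff)
      qed
      moreover have "s \<noteq> 0" using less.prems(4) r(4) by auto
      ultimately have "degree s = 0" using less.hyps by blast
      then show False using q0 r(4) by (simp add: degree_pcompose)
    qed
  qed
qed

section \<open>Balanced products of the form \<open>t * q ^ 3\<close>\<close>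

text \<open>After \<open>t = s ^ 3\<close> the product is a cube, so the coprime parts of the factors are constant and
  the degree of the common factor \<open>g\<close> would be both 0 and 1 modulo 3.\<close>

lemma no_balanced_t_times_cube_char_ne_3:
  fixes p1 p2 p3 q :: "'a::field poly"
  assumes char: "(3::'a) \<noteq> 0" and bal: "p1 + p2 + p3 = 0"
    and prod: "p1 * p2 * p3 = [:0, 1:] * q ^ 3" and q: "q \<noteq> 0"
  shows False
proof -
  let ?f = "monom (1::'a) 3"
  have degf: "degree ?f = 3" by (simp add: degree_monom_eq)
  define Q where "Q = [:0, 1:] * pcompose q ?f"
  have Q0: "Q \<noteq> 0" using q degf by (simp add: Q_def pcompose_eq_0_iff)
  have t: "pcompose [:0, 1:] ?f = [:0, 1:] ^ 3"
    by (simp add: pcompose_pCons monom_altdef)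
  have cube: "pcompose p1 ?f * pcompose p2 ?f * pcompose p3 ?f = Q ^ 3"
    using arg_cong[OF prod, of "\<lambda>p. pcompose p ?f"]
    by (simp only: pcompose_mult pcompose_power t Q_def power_mult_distrib)
  then have "pcompose p1 ?f \<noteq> 0" using Q0 by auto
  then obtain g r1 r2 where g: "pcompose p1 ?f = g * r1" "pcompose p2 ?f = g * r2" "coprime r1 r2"
    by (rule poly_coprime_cofactors)
  define r3 where "r3 = - r1 - r2"
  have "p3 = - p1 - p2" using bal by (simp add: eq_neg_iff_add_eq_0 algebra_simps)
  then have g3: "pcompose p3 ?f = g * r3"
    unfolding r3_def by (simp only: pcompose_diff pcompose_uminus g(1,2)) (simp add: algebra_simps)
  have gQ: "g ^ 3 * (r1 * r2 * r3) = Q ^ 3"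
    using cube g g3 by (simp add: power3_eq_cube algebra_simps)
  have g0: "g \<noteq> 0" using gQ Q0 by auto
  have "g dvd Q" 
    by (rule poly_power_dvd_power_imp_dvd[of g 3]) (use gQ g0 in \<open>auto simp flip: gQ\<close>)
  then obtain s where s: "Q = g * s" by (elim dvdE)
  have cube': "r1 * r2 * r3 = s ^ 3"
    using gQ g0 unfolding s by (simp add: power_mult_distrib)
  have s0: "s \<noteq> 0" using Q0 s by auto
  have ds: "degree s = 0"
    using coprime_balanced_cube_constant[OF char g(3) _ cube' s0] by (simp add: r3_def)
  have "r1 dvd s ^ 3" using cube' by (metis dvd_triv_left mult.assoc)
  then have "degree r1 \<le> degree (s ^ 3)" using s0 by (intro dvd_imp_degree_le) auto
  then have dr: "degree r1 = 0" using ds s0 by (simp add: degree_power_eq)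
  have r0: "r1 \<noteq> 0" using cube' s0 by auto
  have "3 * degree p1 = degree g"
    using arg_cong[OF g(1), of degree] g0 r0 dr degf by (simp add: degree_pcompose degree_mult_eq)
  moreover have "degree Q = degree g"
    using s g0 s0 ds by (simp add: degree_mult_eq)
  moreover have "degree Q = 1 + 3 * degree q"
    using Q0 degf unfolding Q_def by (subst degree_mult_eq) (auto simp: degree_pcompose)
  ultimately show False by presburger
qed

text \<open>The substitution \<open>t = s ^ 3\<close> is of no help here, being inseparable. The derivation with respect
  to \<open>t\<close> takes its place: it sees only the factor \<open>t\<close> of \<open>t * q ^ 3\<close>.\<close>

lemma no_balanced_t_times_cube_char_3:
  fixes p1 p2 p3 q :: "'a::field poly"
  assumes char: "(3::'a) = 0" and bal: "p1 + p2 + p3 = 0"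
    and prod: "p1 * p2 * p3 = [:0, 1:] * q ^ 3" and q: "q \<noteq> 0"
  shows False
proof -
  have three: "(3::'a poly) = 0" using char by (simp add: numeral_poly)
  have p10: "p1 \<noteq> 0" using prod q by auto
  obtain g r1 r2 where g: "p1 = g * r1" "p2 = g * r2" "coprime r1 r2"
    using poly_coprime_cofactors[OF p10] by metis
  define r3 where "r3 = - r1 - r2"
  define N where "N = r1 * r2 * r3"
  define d where "d = r1 - r2"
  have p3: "p3 = - p1 - p2" using bal by (simp add: eq_neg_iff_add_eq_0 algebra_simps)
  have gN: "g ^ 3 * N = [:0, 1:] * q ^ 3"
    unfolding prod[symmetric] p3 g N_def r3_def by (simp add: power3_eq_cube algebra_simps)
  have g0: "g \<noteq> 0" using p10 g by auto
  have N0: "N \<noteq> 0" using gN q by auto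
  have cube': "pderiv (h ^ 3) = 0" for h :: "'a poly"
    using char by (simp add: pderiv_power)
  have "g ^ 3 * pderiv N = q ^ 3"
    using arg_cong[OF gN, of pderiv] by (simp add: pderiv_mult cube' pderiv_pCons)
  then have "g ^ 3 * N = g ^ 3 * ([:0, 1:] * pderiv N)"
    using gN by (simp add: algebra_simps)
  then have NN: "N = [:0, 1:] * pderiv N"
    using g0 by (metis mult_left_cancel power_not_zero)
  have N': "pderiv N = - (wronskian r1 r2 * d)"
    using pderiv_balanced_product[of r1 r2 r3] three
    by (simp add: N_def d_def r3_def)
  \<comment> \<open>In characteristic 3 the three factors are \<open>r1\<close>, \<open>r1 - d\<close> and \<open>r1 + d\<close>.\<close>
  have r2: "r2 = r1 - d" by (simp add: d_def)
  have Nd: "N = r1 ^ 3 - r1 * d ^ 2"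
  proof -
    have "N = r1 ^ 3 - r1 * d ^ 2 + 3 * (r1 ^ 2 * d - r1 ^ 3)"
      unfolding N_def r3_def r2 by (simp add: algebra_simps power2_eq_square power3_eq_cube)
    then show ?thesis using three by simp
  qed
  have "d dvd N" using NN N' by (metis dvd_mult dvd_minus_iff dvd_triv_right)
  then have "d dvd N + d * (r1 * d)" by simp
  then have "d dvd r1 ^ 3" unfolding Nd by (simp add: power2_eq_square algebra_simps)
  moreover have "coprime (r1 ^ 3) d"
  proof (rule coprime_poly_power, rule coprimeI)
    fix c assume "c dvd r1" "c dvd d"
    then have "c dvd r1" "c dvd r2" unfolding r2 by auto
    then show "c dvd 1" using g(3) coprime_common_divisor by blast
  qed
  ultimately have "d dvd 1" by (meson coprime_common_divisor dvd_refl)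
  moreover from this have d0: "d \<noteq> 0" by auto
  ultimately have degd: "degree d = 0" by (simp add: is_unit_iff_degree)
  then have d': "pderiv d = 0" by (metis degree_eq_zeroE pderiv_singleton)
  have W: "wronskian r1 r2 = pderiv r1 * d"
    unfolding wronskian_def r2 by (simp add: pderiv_diff d' algebra_simps)
  have eq: "r1 ^ 3 = r1 * d ^ 2 - [:0, 1:] * (pderiv r1 * d ^ 2)"
  proof -
    have "r1 ^ 3 - r1 * d ^ 2 = [:0, 1:] * - (pderiv r1 * d * d)"
      using NN N' W Nd by metis
    then show ?thesis by (simp add: algebra_simps power2_eq_square)
  qed
  have degd2: "degree (d ^ 2) = 0" using degd d0 by (simp add: degree_power_eq)
  have "degree r1 = 0"
  proof (rule ccontr)
    assume pos: "degree r1 \<noteq> 0"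
    have a: "degree (r1 * d ^ 2) \<le> degree r1"
      using degree_mult_le[of r1 "d ^ 2"] degd2 by simp
    have "degree ([:0, 1:] * (pderiv r1 * d ^ 2)) \<le> 1 + degree (pderiv r1 * d ^ 2)"
      using degree_mult_le[of "[:0, 1:]" "pderiv r1 * d ^ 2"] by simp
    also have "degree (pderiv r1 * d ^ 2) \<le> degree r1 - 1"
      using degree_mult_le[of "pderiv r1" "d ^ 2"] degd2 degree_pderiv_le[of r1] by simp
    finally have b: "degree ([:0, 1:] * (pderiv r1 * d ^ 2)) \<le> degree r1" using pos by simp
    have "degree (r1 ^ 3) \<le> degree r1" unfolding eq using a b by (rule degree_diff_le)
    moreover have "r1 \<noteq> 0" using pos by auto
    ultimately show False using pos by (simp add: degree_power_eq)
  qed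
  then have "pderiv r1 = 0" by (metis degree_eq_zeroE pderiv_singleton)
  then have "pderiv N = 0" unfolding N' W by simp
  then show False using NN N0 by simp
qed

section \<open>From polynomials to rational functions\<close>

lemma fract_common_denominator:
  fixes a1 a2 a3 :: "'a::idom fract"
  obtains p1 p2 p3 q where "q \<noteq> 0"
    "to_fract p1 = a1 * to_fract q" "to_fract p2 = a2 * to_fract q" "to_fract p3 = a3 * to_fract q"
proof -
  have "\<exists>x y. y \<noteq> 0 \<and> to_fract x = a * to_fract y" for a :: "'a fract"
  proof (cases a rule: Fract_cases)
    case (Fract x y)
    then have "to_fract x = a * to_fract y" by (simp add: to_fract_def eq_fract)
    then show ?thesis using Fract(2) by blast
  qed
  then obtain x1 y1 x2 y2 x3 y3 where
    "y1 \<noteq> 0" "to_fract x1 = a1 * to_fract y1" "y2 \<noteq> 0" "to_fract x2 = a2 * to_fract y2"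
    "y3 \<noteq> 0" "to_fract x3 = a3 * to_fract y3" by meson
  then show thesis
    by (intro that[of "y1 * y2 * y3" "x1 * y2 * y3" "x2 * y1 * y3" "x3 * y1 * y2"])
      (simp_all add: algebra_simps)
qed

theorem theorem3:
  shows "\<nexists>a1 a2 a3 :: 'a::field poly fract.
           balanced_factorisation [a1, a2, a3] (indeterminate :: 'a poly fract)"
proof
  assume "\<exists>a1 a2 a3 :: 'a poly fract. balanced_factorisation [a1, a2, a3] indeterminate"
  then obtain a1 a2 a3 :: "'a poly fract"
    where prod: "a1 * a2 * a3 = to_fract [:0, 1:]" and sum: "a1 + a2 + a3 = 0"
    by (auto simp: balanced_factorisation_def indeterminate_def algebra_simps)
  obtain p1 p2 p3 q where q: "q \<noteq> 0" and
    p: "to_fract p1 = a1 * to_fract q" "to_fract p2 = a2 * to_fract q" "to_fract p3 = a3 * to_fract q"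
    by (rule fract_common_denominator)
  have "to_fract (p1 + p2 + p3) = (a1 + a2 + a3) * to_fract q"
    by (simp add: p distrib_right)
  then have bal: "p1 + p2 + p3 = 0" unfolding sum by (simp del: to_fract_add)
  have "to_fract (p1 * p2 * p3) = (a1 * a2 * a3) * to_fract q ^ 3"
    by (simp add: p power3_eq_cube)
  also have "\<dots> = to_fract ([:0, 1:] * q ^ 3)"
    unfolding prod by (simp only: to_fract_mult power3_eq_cube)
  finally have "p1 * p2 * p3 = [:0, 1:] * q ^ 3" by (simp only: to_fract_eq_iff)
  then show False
    using no_balanced_t_times_cube_char_ne_3 no_balanced_t_times_cube_char_3 bal q by blast
qed

end
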